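(* Let $u\in C_c^\infty(\mathbb{R}^3)$ and $\varphi\in C_c^\infty(\mathbb{R}^3,\mathbb{R}^3)$. Then, for every $x\in\mathbb{R}^3$: 1) $\operatorname{curl}^s_\delta D^s_\delta u(x)=0$; 2) $\operatorname{div}^s_\delta\operatorname{curl}^s_\delta\varphi(x)=0$; 3) $\operatorname{curl}^s_\delta\operatorname{curl}^s_\delta\varphi(x)=D^s_\delta\operatorname{div}^s_\delta\varphi(x)-\operatorname{div}^s_\delta D^s_\delta\varphi(x)$.
   Context: Setting: $n=3$, $0<s<1$, $\delta>0$, $\gamma(t)=\pi^{n/2}2^t\Gamma(t/2)/\Gamma(\frac{n-t}{2})$ and $c_{n,s}=\frac{n+s-1}{\gamma(1-s)}$. The cut-off $w_\delta:\mathbb{R}^n\to[0,\infty)$ is a fixed radial function $w_\delta(x)=\bar w_\delta(|x|)$ with $\bar w_\delta\in C_c^\infty([0,\infty))$ nonnegative, nonincreasing, $\operatorname{supp}\bar w_\delta\subset[0,\delta)$, and $\bar w_\delta\equiv a_0:=\max\bar w_\delta$ on $[0,b_0\delta]$ for some $0<b_0<1$. Operators (for smooth compactly supported functions): $D^s_\delta u(x)=c_{n,s}\int_{B(x,\delta)}(u(x)-u(y))\frac{x-y}{|x-y|^{n+s+1}}w_\delta(x-y)\,dy$; $\operatorname{div}^s_\delta\varphi(x)=-c_{n,s}\,\mathrm{pv}_x\int_{B(x,\delta)}(\varphi(x)+\varphi(y))\cdot\frac{x-y}{|x-y|^{n+s+1}}w_\delta(x-y)\,dy$, where $\mathrm{pv}_x$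 means the limit as $r\to0^+$ of the integral with $B(x,r)$ removed; $\operatorname{curl}^s_\delta\varphi(x)=c_{3,s}\int_{B(x,\delta)}(\varphi(x)-\varphi(y))\times\frac{x-y}{|x-y|^{4+s}}w_\delta(x-y)\,dy$. In 3), $\operatorname{div}^s_\delta D^s_\delta\varphi$ is the vector field whose $i$-th component is $\operatorname{div}^s_\delta(D^s_\delta\varphi_i)$. *)

theory Defs
  imports "HOL-Analysis.Analysis"
begin

fun C_diff :: "nat \<Rightarrow> ('a::euclidean_space \<Rightarrow> 'b::real_normed_vector) \<Rightarrow> bool" where
  "C_diff 0 f \<longleftrightarrow> continuous_on UNIV f"
| "C_diff (Suc k) f \<longleftrightarrow> (\<forall>x. f differentiable (at x)) \<and>
     (\<forall>v. C_diff k (\<lambda>x. frechet_derivative f (at x) v))"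

definition test_function :: "('a::euclidean_space \<Rightarrow> 'b::real_normed_vector) \<Rightarrow> bool" where
  "test_function f \<longleftrightarrow> (\<forall>k. C_diff k f) \<and> compact (closure {x. f x \<noteq> 0})"

(* Derivatives at 0 are one-sided; d k is the k-th derivative of f. *)
definition smooth_halfline :: "(real \<Rightarrow> real) \<Rightarrow> bool" where
  "smooth_halfline f \<longleftrightarrow> (\<exists>d :: nat \<Rightarrow> real \<Rightarrow> real.
     (\<forall>t\<ge>0. d 0 t = f t) \<and>
     (\<forall>k. \<forall>t\<ge>0. (d k has_real_derivative d (Suc k) t) (at t within {0..})))"

(* The support is closed and contained in [0, \<delta>), hence compact. Only the values of
   wbar on [0, \<infinity>) matter. *)
definition cutoff_profile :: "real \<Rightarrow> real \<Rightarrow> real \<Rightarrow> (real \<Rightarrow> real) \<Rightarrow> bool" where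
  "cutoff_profile \<delta> a0 b0 wbar \<longleftrightarrow>
     smooth_halfline wbar \<and>
     (\<forall>t\<ge>0. 0 \<le> wbar t) \<and>
     antimono_on {0..} wbar \<and>
     closure {t. 0 \<le> t \<and> wbar t \<noteq> 0} \<subseteq> {0..<\<delta>} \<and>
     a0 \<in> wbar ` {0..} \<and> (\<forall>t\<ge>0. wbar t \<le> a0) \<and>
     0 < b0 \<and> b0 < 1 \<and> (\<forall>t\<in>{0..b0 * \<delta>}. wbar t = a0)"

definition radial_cutoff :: "real \<Rightarrow> ('a::euclidean_space \<Rightarrow> real) \<Rightarrow> bool" where
  "radial_cutoff \<delta> w \<longleftrightarrow>
     (\<exists>wbar a0 b0. cutoff_profile \<delta> a0 b0 wbar \<and> (\<forall>x. w x = wbar (norm x)))"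

definition riesz_const :: "nat \<Rightarrow> real \<Rightarrow> real" where
  "riesz_const n t = pi powr (real n / 2) * 2 powr t * Gamma (t / 2) / Gamma ((real n - t) / 2)"

definition frac_const :: "nat \<Rightarrow> real \<Rightarrow> real" where
  "frac_const n s = (real n + s - 1) / riesz_const n (1 - s)"

definition nl_grad ::
  "real \<Rightarrow> real \<Rightarrow> ('a::euclidean_space \<Rightarrow> real) \<Rightarrow> ('a \<Rightarrow> real) \<Rightarrow> 'a \<Rightarrow> 'a" where
  "nl_grad s \<delta> w u x = frac_const DIM('a) s *\<^sub>R
     (LINT y:ball x \<delta>|lborel.
        ((u x - u y) * w (x - y)) *\<^sub>R ((x - y) /\<^sub>R (norm (x - y) powr (real DIM('a) + s + 1))))"

definition nl_div ::
  "real \<Rightarrow> real \<Rightarrow> ('a::euclidean_space \<Rightarrow> real) \<Rightarrow> ('a \<Rightarrow> 'a) \<Rightarrow> 'a \<Rightarrow> real" where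
  "nl_div s \<delta> w \<phi> x = - frac_const DIM('a) s *
     Lim (at_right 0) (\<lambda>r. LINT y:(ball x \<delta> - ball x r)|lborel.
        ((\<phi> x + \<phi> y) \<bullet> ((x - y) /\<^sub>R (norm (x - y) powr (real DIM('a) + s + 1)))) * w (x - y))"

definition nl_curl ::
  "real \<Rightarrow> real \<Rightarrow> (real^3 \<Rightarrow> real) \<Rightarrow> (real^3 \<Rightarrow> real^3) \<Rightarrow> real^3 \<Rightarrow> real^3" where
  "nl_curl s \<delta> w \<phi> x = frac_const 3 s *\<^sub>R
     (LINT y:ball x \<delta>|lborel.
        w (x - y) *\<^sub>R cross3 (\<phi> x - \<phi> y) ((x - y) /\<^sub>R (norm (x - y) powr (4 + s))))"

definition nl_div_grad ::
  "real \<Rightarrow> real \<Rightarrow> (real^3 \<Rightarrow> real) \<Rightarrow> (real^3 \<Rightarrow> real^3) \<Rightarrow> real^3 \<Rightarrow> real^3" where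
  "nl_div_grad s \<delta> w \<phi> x = (\<chi> i. nl_div s \<delta> w (nl_grad s \<delta> w (\<lambda>y. \<phi> y $ i)) x)"

end

theory Submission imports Defs begin

text \<open>
  All three operators are built from the scalar operators
  \<open>D\<^sub>i f(x) = c \<integral> (f(x) - f(x - z)) K\<^sub>i(z) dz\<close> with the odd kernel
  \<open>K(z) = w(z) z / |z|^(n+s+1)\<close>, for which \<open>|z| |K(z)|\<close> is integrable because \<open>s < 1\<close>.
  Oddness kills the principal value of \<open>\<phi>(x) \<cdot> K\<close>, so the divergence is \<open>\<Sum>\<^sub>i D\<^sub>i \<phi>\<^sub>i\<close>,
  while the curl is minus the usual combination of the \<open>D\<^sub>i \<phi>\<^sub>j\<close>. The three identities then only need
  \<open>D\<^sub>i D\<^sub>j = D\<^sub>j D\<^sub>i\<close>. This is Fubini's theorem: the integrand is the second difference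
  \<open>f(x) - f(x - z') - f(x - z) + f(x - z - z')\<close>, bounded by \<open>M |z| |z'|\<close>, times \<open>K\<^sub>i(z) K\<^sub>j(z')\<close>.
\<close>

subsection \<open>Differences of test functions\<close>

text \<open>A derivative in direction \<open>h\<close> is the combination of the basis derivatives
  with coefficients \<open>h \<bullet> b\<close>, each at most \<open>norm h\<close> in size. Hence
  \<open>\<Sum>b\<in>Basis. B b\<close> bounds the operator norm, and the mean value inequality
  applies. Directional bounds suit \<open>C_diff\<close>, which treats derivatives one direction at
  a time.\<close>

lemma lipschitz_on_UNIV_directional:
  fixes f :: "'a::euclidean_space \<Rightarrow> 'b::real_normed_vector"
  assumes der: "\<And>x. (f has_derivative f' x) (at x)"
    and B: "\<And>x b. b \<in> Basis \<Longrightarrow> norm (f' x b) \<le> B b"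
  shows "(\<Sum>b\<in>Basis. B b)-lipschitz_on UNIV f"
proof (rule lipschitz_onI)
  have Bnn: "0 \<le> B b" if "b \<in> Basis" for b :: 'a
    using B[OF that] norm_ge_zero order_trans by blast
  show "0 \<le> (\<Sum>b\<in>Basis. B b)"
    using Bnn by (intro sum_nonneg) auto
  have onorm: "onorm (f' x) \<le> (\<Sum>b\<in>Basis. B b)" for x
  proof (rule onorm_le)
    fix h
    interpret linear "f' x" using der has_derivative_linear by blast
    have "f' x h = f' x (\<Sum>b\<in>Basis. (h \<bullet> b) *\<^sub>R b)"
      by (simp add: euclidean_representation)
    also have "\<dots> = (\<Sum>b\<in>Basis. (h \<bullet> b) *\<^sub>R f' x b)"
      by (simp add: sum scale)
    also have "norm \<dots> \<le> (\<Sum>b\<in>Basis. norm h * B b)"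
    proof (rule sum_norm_le)
      fix b :: 'a assume b: "b \<in> Basis"
      show "norm ((h \<bullet> b) *\<^sub>R f' x b) \<le> norm h * B b"
        using b B[OF b] Basis_le_norm[OF b] by (auto intro!: mult_mono)
    qed
    finally show "norm (f' x h) \<le> (\<Sum>b\<in>Basis. B b) * norm h"
      by (simp add: sum_distrib_left mult.commute)
  qed
  show "dist (f x) (f y) \<le> (\<Sum>b\<in>Basis. B b) * dist x y" for x y
    unfolding dist_norm using onorm der
    by (intro differentiable_bound[of UNIV f f']) auto
qed

lemma test_function_continuous: "test_function f \<Longrightarrow> continuous_on UNIV f"
  unfolding test_function_def using C_diff.simps(1) by blast

lemma test_function_has_derivative:
  "test_function f \<Longrightarrow> (f has_derivative frechet_derivative f (at x)) (at x)"
  unfolding test_function_def using C_diff.simps(2) frechet_derivative_works by blast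

lemma test_function_bounded:
  assumes "test_function f"
  obtains B where "\<And>x. norm (f x) \<le> B"
proof -
  let ?S = "closure {x. f x \<noteq> 0}"
  have "compact (f ` ?S)"
  proof (rule compact_continuous_image)
    show "continuous_on ?S f"
      by (rule continuous_on_subset[OF test_function_continuous[OF assms]]) simp
    show "compact ?S" using assms unfolding test_function_def by blast
  qed
  then obtain B where "B > 0" and B: "\<And>x. x \<in> ?S \<Longrightarrow> norm (f x) \<le> B"
    using compact_imp_bounded[of "f ` ?S"] unfolding bounded_pos by blast
  have "norm (f x) \<le> B" for x
    using B[of x] \<open>B > 0\<close> closure_subset[of "{x. f x \<noteq> 0}"] by (cases "f x = 0") auto
  then show ?thesis using that by blast
qed

text \<open>Off the closed support, \<open>f\<close> vanishes on an open set and so does its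
  derivative; the new support is a closed subset of a compact set. This gives access to bounds on
  second derivatives.\<close>

lemma test_function_frechet_derivative:
  assumes "test_function f"
  shows "test_function (\<lambda>x. frechet_derivative f (at x) v)"
proof -
  let ?S = "closure {x. f x \<noteq> 0}"
  have "frechet_derivative f (at x) = (\<lambda>_. 0)" if "x \<notin> ?S" for x
  proof -
    have "((\<lambda>_. 0) has_derivative (\<lambda>_. 0)) (at x)" by simp
    then have "(f has_derivative (\<lambda>_. 0)) (at x)"
    proof (rule has_derivative_transform_within_open)
      show "open (- ?S)" by auto
      show "0 = f y" if "y \<in> - ?S" for y
        using that closure_subset[of "{x. f x \<noteq> 0}"] by auto
    qed (use that in auto)
    then show ?thesis by (rule frechet_derivative_at[symmetric])
  qed
  then have "{x. frechet_derivative f (at x) v \<noteq> 0} \<subseteq> ?S" by force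
  then have "closure {x. frechet_derivative f (at x) v \<noteq> 0} \<subseteq> ?S"
    by (simp add: closure_minimal)
  moreover have "C_diff k (\<lambda>x. frechet_derivative f (at x) v)" for k
    using assms C_diff.simps(2) unfolding test_function_def by blast
  moreover have "compact ?S"
    using assms unfolding test_function_def by blast
  ultimately show ?thesis
    using compact_Int_closed[of ?S "closure {x. frechet_derivative f (at x) v \<noteq> 0}"]
    unfolding test_function_def by (simp add: Int_absorb1)
qed

lemma test_function_lipschitz:
  assumes "test_function f"
  obtains L where "L-lipschitz_on UNIV f"
proof -
  have "\<forall>b. \<exists>B. \<forall>x. norm (frechet_derivative f (at x) b) \<le> B"
    using test_function_bounded[OF test_function_frechet_derivative[OF assms]] by metis
  then obtain B where "\<And>x b. norm (frechet_derivative f (at x) b) \<le> B b" by metis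
  then have "(\<Sum>b\<in>Basis. B b)-lipschitz_on UNIV f"
    using lipschitz_on_UNIV_directional[of f "\<lambda>x. frechet_derivative f (at x)" B]
      test_function_has_derivative[OF assms] by simp
  then show ?thesis by (rule that)
qed

text \<open>The difference has derivative \<open>?D x h - ?D (x - z) h\<close>. Directional
  derivatives are test functions, hence Lipschitz, which gives a bound proportional to
  \<open>norm z\<close> with one factor for all \<open>z\<close>.\<close>

lemma test_function_lipschitz_difference:
  assumes "test_function f"
  obtains M where "\<And>z. (M * norm z)-lipschitz_on UNIV (\<lambda>x. f x - f (x - z))"
proof -
  let ?D = "\<lambda>x. frechet_derivative f (at x)"
  have "\<forall>b. \<exists>L. L-lipschitz_on UNIV (\<lambda>x. ?D x b)"
    using test_function_lipschitz[OF test_function_frechet_derivative[OF assms]] by metis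
  then obtain L where L: "\<And>b. (L b)-lipschitz_on UNIV (\<lambda>x. ?D x b)" by metis
  have "((\<Sum>b\<in>Basis. L b) * norm z)-lipschitz_on UNIV (\<lambda>x. f x - f (x - z))" for z
    unfolding sum_distrib_right
  proof (rule lipschitz_on_UNIV_directional)
    fix x
    have "((f \<circ> (\<lambda>x. x - z)) has_derivative ?D (x - z) \<circ> (\<lambda>h. h)) (at x)"
      by (rule diff_chain_at) (auto intro!: derivative_eq_intros test_function_has_derivative[OF assms])
    then have "((\<lambda>x. f (x - z)) has_derivative ?D (x - z)) (at x)"
      by (simp add: o_def)
    then show "((\<lambda>x. f x - f (x - z)) has_derivative (\<lambda>h. ?D x h - ?D (x - z) h)) (at x)"
      using test_function_has_derivative[OF assms] has_derivative_diff by blast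
    show "norm (?D x b - ?D (x - z) b) \<le> L b * norm z" for b
      using lipschitz_onD[OF L, of x "x - z"] by (simp add: dist_norm)
  qed
  then show ?thesis using that by blast
qed

subsection \<open>Difference operators with an odd kernel\<close>

text \<open>The affine map has factor -1, of absolute value 1, so it preserves Lebesgue measure. It
  serves to pass from \<open>y\<close> to \<open>z = x - y\<close> and, with \<open>x = 0\<close>,
  from \<open>z\<close> to \<open>- z\<close>.\<close>

lemma lborel_integral_reflect:
  fixes f :: "'a::euclidean_space \<Rightarrow> 'b::{banach, second_countable_topology}"
  assumes [measurable]: "f \<in> borel_measurable borel"
  shows "(\<integral>z. f (x - z) \<partial>lborel) = (\<integral>z. f z \<partial>lborel)"
proof -
  have "lborel = distr lborel borel (\<lambda>z::'a. x - z)"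
    using lborel_affine[of "-1" x] by (simp add: density_1)
  then have "(\<integral>z. f z \<partial>lborel) = (\<integral>z. f z \<partial>distr lborel borel (\<lambda>z::'a. x - z))"
    by simp
  also have "\<dots> = (\<integral>z. f (x - z) \<partial>lborel)"
    by (rule integral_distr) auto
  finally show ?thesis ..
qed

lemma lipschitz_on_UNIV_borel_measurable:
  "L-lipschitz_on UNIV f \<Longrightarrow> f \<in> borel_measurable borel"
  using lipschitz_on_continuous_on borel_measurable_continuous_onI by blast

text \<open>The weight \<open>norm z\<close> in \<open>K_integrable\<close> is the factor that a
  Lipschitz difference supplies; \<open>K\<close> itself may have a non-integrable singularity at
  0.\<close>

locale odd_kernel =
  fixes K :: "'a::euclidean_space \<Rightarrow> 'a" and c :: real
  assumes odd: "K (- z) = - K z"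
    and K_measurable [measurable]: "K \<in> borel_measurable borel"
    and K_integrable: "integrable lborel (\<lambda>z. norm z * norm (K z))"
begin

text \<open>A nonlocal analogue of the derivative in direction \<open>b\<close>. Integrating over
  the displacement \<open>z\<close> makes its translation invariance visible.\<close>

definition pd :: "'a \<Rightarrow> ('a \<Rightarrow> real) \<Rightarrow> 'a \<Rightarrow> real" where
  "pd b f x = c * (\<integral>z. (f x - f (x - z)) * (K z \<bullet> b) \<partial>lborel)"

lemma integrable_kernel_bound:
  fixes g :: "'a \<Rightarrow> 'b::{banach, second_countable_topology}"
  assumes "g \<in> borel_measurable borel" and "\<And>z. norm (g z) \<le> C * (norm z * norm (K z))"
  shows "integrable lborel g"
proof (rule Bochner_Integration.integrable_bound)
  show "integrable lborel (\<lambda>z. C * (norm z * norm (K z)))"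
    using K_integrable by simp
  show "AE z in lborel. norm (g z) \<le> norm (C * (norm z * norm (K z)))"
    using assms(2) by (intro AE_I2) (metis abs_ge_self order_trans real_norm_def)
qed (use assms in simp)

lemma integrable_difference:
  assumes f: "L-lipschitz_on UNIV f"
  shows "integrable lborel (\<lambda>z. (f x - f (x - z)) * (K z \<bullet> b))"
proof (rule integrable_kernel_bound)
  note [measurable] = lipschitz_on_UNIV_borel_measurable[OF f]
  show "(\<lambda>z. (f x - f (x - z)) * (K z \<bullet> b)) \<in> borel_measurable borel" by measurable
  fix z
  have "\<bar>f x - f (x - z)\<bar> * \<bar>K z \<bullet> b\<bar> \<le> (L * norm z) * (norm (K z) * norm b)"
    using lipschitz_onD[OF f, of x "x - z"] Cauchy_Schwarz_ineq2 lipschitz_on_nonneg[OF f]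
    by (intro mult_mono) (auto simp: dist_norm)
  then show "norm ((f x - f (x - z)) * (K z \<bullet> b)) \<le> (L * norm b) * (norm z * norm (K z))"
    by (simp add: abs_mult mult_ac)
qed

lemma pd_diff:
  assumes "L-lipschitz_on UNIV f" "M-lipschitz_on UNIV g"
  shows "pd b (\<lambda>x. f x - g x) x = pd b f x - pd b g x"
proof -
  have "(\<lambda>z. (f x - g x - (f (x - z) - g (x - z))) * (K z \<bullet> b)) =
      (\<lambda>z. (f x - f (x - z)) * (K z \<bullet> b) - (g x - g (x - z)) * (K z \<bullet> b))"
    by (auto simp: algebra_simps)
  then show ?thesis
    unfolding pd_def using integrable_difference[OF assms(1)] integrable_difference[OF assms(2)]
    by (simp add: right_diff_distrib)
qed

lemma pd_add:
  assumes "L-lipschitz_on UNIV f" "M-lipschitz_on UNIV g"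
  shows "pd b (\<lambda>x. f x + g x) x = pd b f x + pd b g x"
proof -
  have "(\<lambda>z. (f x + g x - (f (x - z) + g (x - z))) * (K z \<bullet> b)) =
      (\<lambda>z. (f x - f (x - z)) * (K z \<bullet> b) + (g x - g (x - z)) * (K z \<bullet> b))"
    by (auto simp: algebra_simps)
  then show ?thesis
    unfolding pd_def using integrable_difference[OF assms(1)] integrable_difference[OF assms(2)]
    by (simp add: distrib_left)
qed

text \<open>Translation invariance merges the two integrals into one against the same kernel, so
  that second differences appear. Both the Lipschitz bound and the Fubini argument start from this
  form.\<close>

lemma pd_translate_diff:
  assumes f: "L-lipschitz_on UNIV f"
  shows "pd b f x - pd b f y =
    c * (\<integral>z. ((f x - f (x - z)) - (f y - f (y - z))) * (K z \<bullet> b) \<partial>lborel)"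
  using integrable_difference[OF f, of x b] integrable_difference[OF f, of y b]
  by (simp add: pd_def left_diff_distrib right_diff_distrib)

text \<open>The hypothesis \<open>M\<close> says that second differences are at most \<open>M |z| |z'|\<close>.\<close>
lemma pd_lipschitz:
  assumes f: "L-lipschitz_on UNIV f"
    and M: "\<And>z. (M * norm z)-lipschitz_on UNIV (\<lambda>x. f x - f (x - z))"
  obtains N where "N-lipschitz_on UNIV (pd b f)"
proof
  define I where "I = (\<integral>z. norm z * norm (K z) \<partial>lborel)"
  \<comment> \<open>A basis vector has norm 1, so the sign of its Lipschitz constant is the sign of
    \<open>M\<close>.\<close>
  have "0 \<le> M * norm (SOME b. b \<in> (Basis :: 'a set))"
    using lipschitz_on_nonneg[OF M] .
  then have "M \<ge> 0" by (simp add: SOME_Basis)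
  have "I \<ge> 0" unfolding I_def by simp
  show "(\<bar>c\<bar> * (M * norm b * I))-lipschitz_on UNIV (pd b f)"
  proof (rule lipschitz_onI)
    fix x y
    have "\<bar>\<integral>z. ((f x - f (x - z)) - (f y - f (y - z))) * (K z \<bullet> b) \<partial>lborel\<bar>
      \<le> (\<integral>z. (M * dist x y * norm b) * (norm z * norm (K z)) \<partial>lborel)"
    proof (rule integral_abs_bound_integral)
      show "integrable lborel (\<lambda>z. ((f x - f (x - z)) - (f y - f (y - z))) * (K z \<bullet> b))"
        using integrable_difference[OF f, of x b] integrable_difference[OF f, of y b]
        by (simp add: left_diff_distrib)
      show "integrable lborel (\<lambda>z. (M * dist x y * norm b) * (norm z * norm (K z)))"
        using K_integrable by simp
      fix z
      have "\<bar>(f x - f (x - z)) - (f y - f (y - z))\<bar> * \<bar>K z \<bullet> b\<bar>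
          \<le> (M * norm z * dist x y) * (norm (K z) * norm b)"
        using lipschitz_onD[OF M, of x y z] Cauchy_Schwarz_ineq2 \<open>M \<ge> 0\<close>
        by (intro mult_mono) (auto simp: dist_real_def)
      then show "\<bar>((f x - f (x - z)) - (f y - f (y - z))) * (K z \<bullet> b)\<bar>
          \<le> (M * dist x y * norm b) * (norm z * norm (K z))"
        by (simp add: abs_mult mult_ac)
    qed
    then have "\<bar>c\<bar> * \<bar>\<integral>z. ((f x - f (x - z)) - (f y - f (y - z))) * (K z \<bullet> b) \<partial>lborel\<bar>
       \<le> \<bar>c\<bar> * ((M * dist x y * norm b) * I)"
      unfolding I_def by (intro mult_left_mono) auto
    then show "dist (pd b f x) (pd b f y) \<le> \<bar>c\<bar> * (M * norm b * I) * dist x y"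
      by (simp add: dist_real_def pd_translate_diff[OF f] abs_mult mult_ac)
  qed (use \<open>M \<ge> 0\<close> \<open>I \<ge> 0\<close> in simp)
qed

lemma pd_commute:
  assumes f: "L-lipschitz_on UNIV f"
    and M: "\<And>z. (M * norm z)-lipschitz_on UNIV (\<lambda>x. f x - f (x - z))"
  shows "pd a (pd b f) x = pd b (pd a f) x"
proof -
  note [measurable] = lipschitz_on_UNIV_borel_measurable[OF f]
  define F where "F = (\<lambda>z z'. ((f x - f (x - z')) - (f (x - z) - f (x - z - z'))) *
    (K z' \<bullet> b) * (K z \<bullet> a))"
  define G where "G = (\<lambda>z z'. (M * norm a * norm b * (norm z * norm (K z))) * (norm z' * norm (K z')))"
  \<comment> \<open>The majorant is a product of a function of \<open>z\<close> and one of
    \<open>z'\<close>, so \<open>K_integrable\<close> makes it integrable on the product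
    space.\<close>
  have "integrable (lborel \<Otimes>\<^sub>M lborel) (case_prod G)"
    unfolding G_def
    by (rule lborel_pair.Fubini_integrable)
      (use K_integrable in \<open>auto simp: abs_mult intro!: integrable_mult_left integrable_mult_right\<close>)
  then have F: "integrable (lborel \<Otimes>\<^sub>M lborel) (case_prod F)"
  proof (rule Bochner_Integration.integrable_bound)
    show "case_prod F \<in> borel_measurable (lborel \<Otimes>\<^sub>M lborel)"
      unfolding F_def by measurable
    have "norm (F z z') \<le> norm (G z z')" for z z'
    proof -
      have "\<bar>(f x - f (x - z')) - (f (x - z) - f (x - z - z'))\<bar> * \<bar>K z' \<bullet> b\<bar> * \<bar>K z \<bullet> a\<bar>
        \<le> (M * norm z' * norm z) * (norm (K z') * norm b) * (norm (K z) * norm a)"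
        using lipschitz_onD[OF M, of x "x - z" z'] Cauchy_Schwarz_ineq2 lipschitz_on_nonneg[OF M]
        by (intro mult_mono) (auto simp: dist_norm)
      also have "\<dots> = G z z'" by (simp add: G_def mult_ac)
      finally show ?thesis by (simp add: F_def abs_mult)
    qed
    then show "AE p in lborel \<Otimes>\<^sub>M lborel. norm (case_prod F p) \<le> norm (case_prod G p)"
      by auto
  qed
  have "pd a (pd b f) x = c * c * (\<integral>z. \<integral>z'. F z z' \<partial>lborel \<partial>lborel)"
    unfolding pd_def[of a] pd_translate_diff[OF f] F_def by (simp add: mult_ac)
  also have "\<dots> = c * c * (\<integral>z'. \<integral>z. F z z' \<partial>lborel \<partial>lborel)"
    using lborel_pair.Fubini_integral[OF F] by simp
  also have "\<dots> = pd b (pd a f) x"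
  proof -
    \<comment> \<open>The second difference is symmetric in \<open>z\<close> and \<open>z'\<close>;
      exchanging them therefore exchanges only \<open>a\<close> and \<open>b\<close>.\<close>
    have "(\<lambda>z. F z z') = (\<lambda>z. ((f x - f (x - z)) - (f (x - z') - f (x - z' - z))) * (K z \<bullet> a) * (K z' \<bullet> b))" for z'
      unfolding F_def by (auto simp: algebra_simps)
    then show ?thesis
      unfolding pd_def[of b] pd_translate_diff[OF f] by (simp add: mult_ac)
  qed
  finally show ?thesis .
qed

text \<open>Write the sum as \<open>2 * \<phi> x\<close> minus the difference. Outside a ball around
  0 the constant part integrates to 0 against the odd kernel; the difference has an integrable
  product with \<open>K\<close>, so its integrals converge as the ball shrinks.\<close>

lemma principal_value:
  fixes \<phi> :: "'a \<Rightarrow> 'a"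
  assumes \<phi>: "L-lipschitz_on UNIV \<phi>"
  shows "((\<lambda>r. \<integral>z. indicator (- ball 0 r) z * ((\<phi> x + \<phi> (x - z)) \<bullet> K z) \<partial>lborel)
    \<longlongrightarrow> - (\<integral>z. (\<phi> x - \<phi> (x - z)) \<bullet> K z \<partial>lborel)) (at_right 0)"
proof (rule tendsto_at_right_sequentially)
  \<comment> \<open>Dominated convergence is sequential, so the limit is tested along sequences of
    radii; the upper end 1 for them is arbitrary.\<close>
  show "(0::real) < 1" by simp
next
  note [measurable] = lipschitz_on_UNIV_borel_measurable[OF \<phi>]
  let ?g = "\<lambda>z. (\<phi> x - \<phi> (x - z)) \<bullet> K z"
  have g: "integrable lborel ?g"
  proof (rule integrable_kernel_bound)
    fix z
    have "\<bar>?g z\<bar> \<le> norm (\<phi> x - \<phi> (x - z)) * norm (K z)"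
      by (rule Cauchy_Schwarz_ineq2)
    also have "\<dots> \<le> (L * norm z) * norm (K z)"
      using lipschitz_onD[OF \<phi>, of x "x - z"] by (intro mult_right_mono) (auto simp: dist_norm)
    finally show "norm (?g z) \<le> L * (norm z * norm (K z))" by (simp add: mult_ac)
  qed measurable
  have annulus: "(\<integral>z. indicator (- ball 0 r) z * ((\<phi> x + \<phi> (x - z)) \<bullet> K z) \<partial>lborel)
      = - (\<integral>z. indicator (- ball 0 r) z * ?g z \<partial>lborel)" if "r > 0" for r
  proof -
    let ?h = "\<lambda>z. indicator (- ball 0 r) z * (\<phi> x \<bullet> K z)"
    have h: "integrable lborel ?h"
    proof (rule integrable_kernel_bound)
      fix z
      \<comment> \<open>Where the indicator is nonzero, \<open>norm z / r\<close> is at least 1;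
        this inserts the missing weight.\<close>
      have "\<bar>?h z\<bar> \<le> norm z / r * (norm (\<phi> x) * norm (K z))"
        unfolding abs_mult using \<open>r > 0\<close> Cauchy_Schwarz_ineq2
        by (intro mult_mono) (auto simp: indicator_def)
      then show "norm (?h z) \<le> (norm (\<phi> x) / r) * (norm z * norm (K z))"
        by (simp add: mult_ac)
    qed measurable
    \<comment> \<open>Reflection at 0 changes the sign of \<open>?h\<close>, so its integral equals
      its own negative.\<close>
    have "(\<integral>z. ?h (0 - z) \<partial>lborel) = (\<integral>z. ?h z \<partial>lborel)"
      by (rule lborel_integral_reflect) measurable
    moreover have "?h (0 - z) = - ?h z" for z
      by (simp add: odd indicator_def)
    ultimately have h0: "(\<integral>z. ?h z \<partial>lborel) = 0"
      by simp
    have "(\<lambda>z. indicator (- ball 0 r) z * ((\<phi> x + \<phi> (x - z)) \<bullet> K z)) =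
        (\<lambda>z. 2 * ?h z - indicator (- ball 0 r) z * ?g z)"
      by (auto simp: algebra_simps)
    moreover have "integrable lborel (\<lambda>z. indicator (- ball 0 r) z * ?g z)"
      using integrable_mult_indicator[OF _ g, of "- ball 0 r"] by simp
    ultimately show ?thesis using h h0 by simp
  qed
  fix S :: "nat \<Rightarrow> real"
  assume S: "\<And>n. 0 < S n" "S \<longlonglongrightarrow> 0"
  have "(\<lambda>n. \<integral>z. indicator (- ball 0 (S n)) z * ?g z \<partial>lborel) \<longlonglongrightarrow> (\<integral>z. ?g z \<partial>lborel)"
  proof (rule integral_dominated_convergence[where w = "\<lambda>z. norm (?g z)"])
    have "(\<lambda>n. indicator (- ball 0 (S n)) z * ?g z) \<longlonglongrightarrow> ?g z" for z
    proof (cases "z = 0")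
      case False
      then have "\<forall>\<^sub>F n in sequentially. S n < norm z"
        using S(2) order_tendstoD(2) by fastforce
      then have "\<forall>\<^sub>F n in sequentially. indicator (- ball 0 (S n)) z * ?g z = ?g z"
        by eventually_elim (auto simp: indicator_def)
      then show ?thesis by (rule tendsto_eventually)
    qed simp
    then show "AE z in lborel. (\<lambda>n. indicator (- ball 0 (S n)) z * ?g z) \<longlonglongrightarrow> ?g z"
      by simp
    show "integrable lborel (\<lambda>z. norm (?g z))" using g by simp
  qed (auto simp: indicator_def)
  then show "(\<lambda>n. \<integral>z. indicator (- ball 0 (S n)) z * ((\<phi> x + \<phi> (x - z)) \<bullet> K z) \<partial>lborel)
      \<longlonglongrightarrow> - (\<integral>z. ?g z \<partial>lborel)"
    using S(1) by (simp add: annulus tendsto_minus)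
qed

end

subsection \<open>The truncated Riesz kernel\<close>

text \<open>Dyadic decomposition: on the shell between radii \<open>r (Suc k)\<close> and
  \<open>r k\<close> the integrand is at most \<open>r (Suc k) powr (- a)\<close>. Replacing the
  shell by the whole ball of radius \<open>r k\<close> gives an explicit volume, and the resulting
  series is geometric with ratio \<open>q\<close>, below 1 because \<open>a\<close> is less than the
  dimension.\<close>

lemma nn_integral_norm_powr_ball_finite:
  fixes a \<delta> :: real
  assumes "0 \<le> a" "a < DIM('a::euclidean_space)" "\<delta> > 0"
  shows "(\<integral>\<^sup>+z. ennreal (indicator (ball 0 \<delta>) z * norm z powr (- a)) \<partial>(lborel :: 'a measure)) < \<infinity>"
proof -
  define r where "r k = \<delta> * (1/2) ^ k" for k :: nat
  define v where "v = unit_ball_vol (DIM('a))"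
  have r_pos: "r k > 0" for k using assms by (simp add: r_def)
  have r_lim: "r \<longlonglongrightarrow> 0"
    unfolding r_def by (intro tendsto_mult_right_zero LIMSEQ_power_zero) simp
  have v: "v \<ge> 0" by (simp add: v_def)
  define g where "g k z = ennreal (r (Suc k) powr (- a)) * indicator (ball (0::'a) (r k)) z" for k z
  have [measurable]: "g k \<in> borel_measurable borel" for k
    unfolding g_def by (intro borel_measurable_times_ennreal borel_measurable_indicator) auto
  have term_le_suminf: "h k \<le> suminf h" for h :: "nat \<Rightarrow> ennreal" and k
    using sum_le_suminf[OF summableI, of "{k}" h] by simp
  txt \<open>The dyadic shell containing \<open>z\<close> contributes a term that dominates the left-hand side.\<close>
  have bound: "ennreal (indicator (ball 0 \<delta>) z * norm z powr (- a)) \<le> (\<Sum>k. g k z)" for z :: 'a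
  proof (cases "z \<in> ball 0 \<delta> \<and> z \<noteq> 0")
    case True
    then have ex: "\<exists>k. r k \<le> norm z"
      using order_tendstoD(2)[OF r_lim, of "norm z"] by (auto simp: eventually_sequentially intro: less_imp_le)
    define m where "m = (LEAST k. r k \<le> norm z)"
    have m: "r m \<le> norm z" unfolding m_def using ex by (rule LeastI_ex)
    \<comment> \<open>Since \<open>r 0 = \<delta>\<close> exceeds \<open>norm z\<close>, the least
      index has a predecessor \<open>k\<close>, and minimality gives
      \<open>norm z < r k\<close>.\<close>
    have "m \<noteq> 0" using m True by (cases m) (auto simp: r_def)
    then obtain k where k: "m = Suc k" by (cases m) auto
    have "norm z < r k"
      using not_less_Least[of k "\<lambda>k. r k \<le> norm z"] k by (auto simp: m_def)
    then have "ennreal (indicator (ball 0 \<delta>) z * norm z powr (- a)) \<le> g k z"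
      using True m k r_pos[of m] assms(1)
      by (auto simp: g_def powr_minus intro!: ennreal_leI le_imp_inverse_le powr_mono2)
    also have "\<dots> \<le> (\<Sum>k. g k z)"
      by (rule term_le_suminf)
    finally show ?thesis .
  \<comment> \<open>At \<open>z = 0\<close> the convention \<open>0 powr (- a) = 0\<close> makes the
    left-hand side vanish.\<close>
  qed auto
  define q where "q = (1/2::real) powr (DIM('a) - a)"
  have q: "0 \<le> q" "q < 1"
    using assms(2) powr_less_mono2[of "DIM('a) - a" "1/2" 1] by (auto simp: q_def)
  define C where "C = (\<delta> / 2) powr (- a) * (v * \<delta> ^ DIM('a))"
  have shell: "r (Suc k) powr (- a) * (v * r k ^ DIM('a)) = C * q ^ k" for k
  proof -
    have half: "(1/2::real) ^ k = (1/2) powr k" by (simp add: powr_realpow)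
    have "r (Suc k) = \<delta> / 2 * (1/2) powr k"
      by (simp add: r_def half[symmetric])
    then have "r (Suc k) powr (- a) = (\<delta> / 2) powr (- a) * ((1/2) powr k) powr (- a)"
      using assms(3) by (simp only: powr_mult)
    then have "r (Suc k) powr (- a) = (\<delta> / 2) powr (- a) * (1/2) powr (- a * k)"
      by (simp only: powr_powr mult.commute)
    moreover have "r k ^ DIM('a) = \<delta> ^ DIM('a) * (1/2) powr (DIM('a) * k)"
      by (simp add: r_def power_mult_distrib powr_realpow mult.commute flip: power_mult of_nat_mult)
    moreover have "q ^ k = (1/2) powr (- a * k) * (1/2) powr (DIM('a) * k)"
      unfolding powr_add[symmetric] q_def
      by (subst powr_realpow[symmetric]) (simp_all add: powr_powr algebra_simps)
    ultimately show ?thesis by (simp add: C_def mult_ac)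
  qed
  have "(\<integral>\<^sup>+z. ennreal (indicator (ball 0 \<delta>) z * norm z powr (- a)) \<partial>(lborel :: 'a measure))
      \<le> (\<integral>\<^sup>+z. (\<Sum>k. g k z) \<partial>lborel)"
    using bound by (intro nn_integral_mono) auto
  moreover have "(\<integral>\<^sup>+z. (\<Sum>k. g k z) \<partial>lborel) = (\<Sum>k. \<integral>\<^sup>+z. g k z \<partial>lborel)"
    by (rule nn_integral_suminf) simp
  moreover have "(\<Sum>k. \<integral>\<^sup>+z. g k z \<partial>lborel) = (\<Sum>k. ennreal (C * q ^ k))"
  proof (rule suminf_cong)
    fix k
    have "(\<integral>\<^sup>+z. g k z \<partial>lborel) = ennreal (r (Suc k) powr (- a)) * emeasure lborel (ball (0::'a) (r k))"
      unfolding g_def by (rule nn_integral_cmult_indicator) simp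
    also have "\<dots> = ennreal (r (Suc k) powr (- a)) * ennreal (v * r k ^ DIM('a))"
      using r_pos[of k] unfolding v_def by (subst emeasure_ball) auto
    also have "\<dots> = ennreal (C * q ^ k)"
      by (subst ennreal_mult'[symmetric]) (simp, simp only: shell)
    finally show "(\<integral>\<^sup>+z. g k z \<partial>lborel) = ennreal (C * q ^ k)" .
  qed
  moreover have "(\<Sum>k. ennreal (C * q ^ k)) < \<infinity>"
  proof -
    have "summable (\<lambda>k. C * q ^ k)"
      using q by (intro summable_mult summable_geometric) auto
    moreover have "C \<ge> 0" using v assms(3) by (simp add: C_def)
    ultimately show ?thesis
      using q by (simp add: suminf_ennreal2)
  qed
  ultimately show ?thesis
    by (simp only: order.strict_trans1)
qed

text \<open>The indicator moves the domain of integration into the kernel: with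
  \<open>z = x - y\<close>, integrals over \<open>ball x \<delta>\<close> become integrals over the
  whole space.\<close>

definition nl_kernel :: "real \<Rightarrow> real \<Rightarrow> ('a::euclidean_space \<Rightarrow> real) \<Rightarrow> 'a \<Rightarrow> 'a" where
  "nl_kernel s \<delta> w z =
    (indicator (ball 0 \<delta>) z * w z) *\<^sub>R (z /\<^sub>R (norm z powr (real DIM('a) + s + 1)))"

text \<open>Each property feeds one condition on the kernel: continuity gives measurability,
  evenness gives oddness, and the bounds give integrability.\<close>

lemma radial_cutoffE:
  assumes "radial_cutoff \<delta> w"
  obtains a0 where "continuous_on UNIV w" "\<And>x. w (- x) = w x" "\<And>x. 0 \<le> w x" "\<And>x. w x \<le> a0"
proof -
  obtain wbar a0 b0 where c: "cutoff_profile \<delta> a0 b0 wbar" and w: "w = (\<lambda>x. wbar (norm x))"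
    using assms unfolding radial_cutoff_def fun_eq_iff by blast
  obtain d where d: "\<And>t. t \<ge> 0 \<Longrightarrow> d 0 t = wbar t"
      "\<And>k t. t \<ge> 0 \<Longrightarrow> (d k has_real_derivative d (Suc k) t) (at t within {0..})"
    using c unfolding cutoff_profile_def smooth_halfline_def by metis
  have "continuous_on {0..} (d 0)"
    using d(2) by (intro DERIV_continuous_on) auto
  then have "continuous_on {0..} wbar"
    using d(1) by (subst (asm) continuous_on_cong[where g = wbar]) auto
  then have "continuous_on UNIV w"
    unfolding w by (rule continuous_on_compose2) (auto intro: continuous_on_norm_id)
  moreover have "0 \<le> w x" "w x \<le> a0" for x
    using c unfolding w cutoff_profile_def by auto
  moreover have "w (- x) = w x" for x
    unfolding w by simp
  ultimately show ?thesis
    by (intro that)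
qed

lemma odd_kernel_nl_kernel:
  fixes w :: "'a::euclidean_space \<Rightarrow> real"
  assumes s: "0 < s" "s < 1" and "\<delta> > 0" and w: "radial_cutoff \<delta> w"
  shows "odd_kernel (nl_kernel s \<delta> w)"
proof
  obtain a0 where cont: "continuous_on UNIV w" and even: "\<And>x. w (- x) = w x"
    and wb: "\<And>x. 0 \<le> w x" "\<And>x. w x \<le> a0"
    using radial_cutoffE[OF w] by blast
  have [measurable]: "w \<in> borel_measurable borel"
    using cont by (rule borel_measurable_continuous_onI)
  have [measurable]: "ball (0::'a) \<delta> \<in> sets borel" by simp
  show "nl_kernel s \<delta> w (- z) = - nl_kernel s \<delta> w z" for z
    by (simp add: nl_kernel_def even indicator_def)
  show meas [measurable]: "nl_kernel s \<delta> w \<in> borel_measurable borel"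
    unfolding nl_kernel_def[abs_def] by measurable
  \<comment> \<open>The weighted kernel has size \<open>w z * norm z powr (- a)\<close> on the ball
    away from 0; \<open>s < 1\<close> puts \<open>a\<close> below the dimension.\<close>
  define a where "a = real DIM('a) + s - 1"
  have a: "0 \<le> a" "a < DIM('a)"
    using s DIM_positive[where 'a='a] unfolding a_def by linarith+
  have "(\<lambda>z::'a. indicator (ball 0 \<delta>) z * norm z powr (- a)) \<in> borel_measurable borel"
    by measurable
  then have "integrable lborel (\<lambda>z::'a. indicator (ball 0 \<delta>) z * norm z powr (- a))"
    using nn_integral_norm_powr_ball_finite[OF a \<open>\<delta> > 0\<close>]
    by (intro integrableI_bounded) (auto simp: abs_mult)
  then have "integrable lborel (\<lambda>z::'a. a0 * (indicator (ball 0 \<delta>) z * norm z powr (- a)))"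
    by simp
  then show "integrable lborel (\<lambda>z. norm z * norm (nl_kernel s \<delta> w z))"
  proof (rule Bochner_Integration.integrable_bound)
    have "norm z * norm (nl_kernel s \<delta> w z) \<le> a0 * (indicator (ball 0 \<delta>) z * norm z powr (- a))" for z
    proof (cases "z = 0")
      case False
      have "norm z powr (- a) = norm z powr 2 / norm z powr (real DIM('a) + s + 1)"
        unfolding powr_diff[symmetric] a_def by (simp add: algebra_simps)
      then have "norm z * norm (nl_kernel s \<delta> w z) = w z * (indicator (ball 0 \<delta>) z * norm z powr (- a))"
        using wb(1)[of z] False
        by (simp add: nl_kernel_def abs_mult power2_eq_square divide_inverse)
      then show ?thesis
        using wb(2)[of z] by (auto intro!: mult_right_mono)
    qed (simp add: nl_kernel_def)
    then show "AE z in lborel. norm (norm z * norm (nl_kernel s \<delta> w z))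
        \<le> norm (a0 * (indicator (ball 0 \<delta>) z * norm z powr (- a)))"
      by (intro AE_I2) (force intro: order_trans[OF _ abs_ge_self])
  qed measurable
qed

subsection \<open>The operators in components\<close>

lemma lipschitz_on_vec_nth:
  fixes f :: "'a::metric_space \<Rightarrow> real ^ 'n"
  assumes "L-lipschitz_on S f"
  shows "L-lipschitz_on S (\<lambda>x. f x $ i)"
  using assms dist_vec_nth_le order_trans unfolding lipschitz_on_def by blast

text \<open>The Euclidean norm is at most the sum of the absolute coordinates, so the constants of
  the components add up.\<close>

lemma lipschitz_on_vec_lambda:
  fixes f :: "'a::metric_space \<Rightarrow> real ^ 'n"
  assumes "\<And>i. \<exists>L. L-lipschitz_on S (\<lambda>x. f x $ i)"
  obtains L where "L-lipschitz_on S f"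
proof -
  obtain L where L: "\<And>i. (L i)-lipschitz_on S (\<lambda>x. f x $ i)" using assms by metis
  have "(\<Sum>i\<in>UNIV. L i)-lipschitz_on S f"
  proof (rule lipschitz_onI)
    fix x y assume xy: "x \<in> S" "y \<in> S"
    have "dist (f x) (f y) \<le> (\<Sum>i\<in>UNIV. dist (f x $ i) (f y $ i))"
      using norm_le_l1_cart[of "f x - f y"] by (simp add: dist_norm)
    also have "\<dots> \<le> (\<Sum>i\<in>UNIV. L i * dist x y)"
      using lipschitz_onD[OF L xy] by (intro sum_mono) auto
    finally show "dist (f x) (f y) \<le> (\<Sum>i\<in>UNIV. L i) * dist x y"
      by (simp add: sum_distrib_right)
  qed (use lipschitz_on_nonneg[OF L] in \<open>auto intro: sum_nonneg\<close>)
  then show ?thesis using that by blast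
qed

lemma DIM_3: "DIM(real^3) = 3"
  by simp

lemma borel_measurable_cross3 [measurable]:
  assumes "f \<in> borel_measurable M" "g \<in> borel_measurable M"
  shows "(\<lambda>x. cross3 (f x) (g x)) \<in> borel_measurable M"
  by (rule borel_measurable_continuous_Pair[OF assms])
    (intro continuous_on_cross continuous_intros)

locale nl_operators =
  fixes s \<delta> :: real and w :: "real^3 \<Rightarrow> real"
  assumes s: "0 < s" "s < 1" and \<delta>: "0 < \<delta>" and w: "radial_cutoff \<delta> w"
begin

sublocale odd_kernel "nl_kernel s \<delta> w" "frac_const 3 s"
  using s \<delta> w by (rule odd_kernel_nl_kernel)

abbreviation D :: "3 \<Rightarrow> (real^3 \<Rightarrow> real) \<Rightarrow> real^3 \<Rightarrow> real" where
  "D i \<equiv> pd (axis i 1)"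

abbreviation K :: "real^3 \<Rightarrow> real^3" where
  "K \<equiv> nl_kernel s \<delta> w"

lemma w_measurable [measurable]: "w \<in> borel_measurable borel"
  using w radial_cutoffE borel_measurable_continuous_onI by blast

lemma ball_borel [measurable]: "ball (x::real^3) r \<in> sets borel"
  by simp

lemma integrable_component:
  assumes "L-lipschitz_on UNIV f"
  shows "integrable lborel (\<lambda>z. (f x - f (x - z)) * K z $ i)"
  using integrable_difference[OF assms, of x "axis i 1"] by (simp add: inner_axis)

lemma D_eq: "D i f x = frac_const 3 s * (\<integral>z. (f x - f (x - z)) * K z $ i \<partial>lborel)"
  by (simp add: pd_def inner_axis)

text \<open>Substituting \<open>y = x - z\<close> produces the kernel. A coordinate projection is
  bounded linear and passes under the integral once the whole vector field is known to be
  integrable.\<close>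

lemma nl_grad_component:
  assumes f: "L-lipschitz_on UNIV f"
  shows "nl_grad s \<delta> w f x $ i = D i f x"
proof -
  note [measurable] = lipschitz_on_UNIV_borel_measurable[OF f]
  have int: "integrable lborel (\<lambda>z. (f x - f (x - z)) *\<^sub>R K z)"
  proof (rule integrable_kernel_bound)
    show "norm ((f x - f (x - z)) *\<^sub>R K z) \<le> L * (norm z * norm (K z))" for z
      using mult_right_mono[OF lipschitz_onD[OF f, of x "x - z"], of "norm (K z)"]
      by (simp add: dist_norm mult_ac)
  qed measurable
  let ?h = "\<lambda>y. indicator (ball x \<delta>) y *\<^sub>R (((f x - f y) * w (x - y)) *\<^sub>R
      ((x - y) /\<^sub>R (norm (x - y) powr (4 + s))))"
  have "nl_grad s \<delta> w f x = frac_const 3 s *\<^sub>R (\<integral>y. ?h y \<partial>lborel)"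
    unfolding nl_grad_def DIM_3 set_lebesgue_integral_def by (simp add: add_ac)
  also have "(\<integral>y. ?h y \<partial>lborel) = (\<integral>z. ?h (x - z) \<partial>lborel)"
    by (rule lborel_integral_reflect[symmetric]) measurable
  also have "(\<lambda>z. ?h (x - z)) = (\<lambda>z. (f x - f (x - z)) *\<^sub>R K z)"
    by (auto simp: nl_kernel_def indicator_def dist_norm add_ac mult_ac)
  finally show ?thesis
    using int by (simp add: D_eq integral_bounded_linear[OF bounded_linear_vec_nth, symmetric])
qed

lemma nl_div_eq:
  assumes \<phi>: "L-lipschitz_on UNIV \<phi>"
  shows "nl_div s \<delta> w \<phi> x =
    D 1 (\<lambda>y. \<phi> y $ 1) x + D 2 (\<lambda>y. \<phi> y $ 2) x + D 3 (\<lambda>y. \<phi> y $ 3) x"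
proof -
  note [measurable] = lipschitz_on_UNIV_borel_measurable[OF \<phi>]
  let ?X = "\<lambda>r. LINT y:(ball x \<delta> - ball x r)|lborel.
        ((\<phi> x + \<phi> y) \<bullet> ((x - y) /\<^sub>R (norm (x - y) powr (4 + s)))) * w (x - y)"
  have X: "?X r = (\<integral>z. indicator (- ball 0 r) z * ((\<phi> x + \<phi> (x - z)) \<bullet> K z) \<partial>lborel)" for r
  proof -
    let ?h = "\<lambda>y. indicator (ball x \<delta> - ball x r) y *\<^sub>R
        (((\<phi> x + \<phi> y) \<bullet> ((x - y) /\<^sub>R (norm (x - y) powr (4 + s)))) * w (x - y))"
    have "?X r = (\<integral>y. ?h y \<partial>lborel)"
      by (simp add: set_lebesgue_integral_def)
    also have "\<dots> = (\<integral>z. ?h (x - z) \<partial>lborel)"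
      by (rule lborel_integral_reflect[symmetric]) measurable
    also have "(\<lambda>z. ?h (x - z)) = (\<lambda>z. indicator (- ball 0 r) z * ((\<phi> x + \<phi> (x - z)) \<bullet> K z))"
      by (auto simp: nl_kernel_def indicator_def dist_norm add_ac)
    finally show ?thesis .
  qed
  \<comment> \<open>This minus sign cancels the one in \<open>nl_div\<close>.\<close>
  have "Lim (at_right 0) ?X = - (\<integral>z. (\<phi> x - \<phi> (x - z)) \<bullet> K z \<partial>lborel)"
    unfolding X by (intro tendsto_Lim principal_value[OF \<phi>]) simp
  then have nl_div: "nl_div s \<delta> w \<phi> x = frac_const 3 s * (\<integral>z. (\<phi> x - \<phi> (x - z)) \<bullet> K z \<partial>lborel)"
    unfolding nl_div_def DIM_3 by (simp add: add_ac)
  have "(\<lambda>z. (\<phi> x - \<phi> (x - z)) \<bullet> K z) = (\<lambda>z. (\<phi> x $ 1 - \<phi> (x - z) $ 1) * K z $ 1 +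
      (\<phi> x $ 2 - \<phi> (x - z) $ 2) * K z $ 2 + (\<phi> x $ 3 - \<phi> (x - z) $ 3) * K z $ 3)"
    by (simp add: inner_vec_def sum_3)
  then show ?thesis
    unfolding nl_div D_eq
    by (simp add: distrib_left integrable_component[OF lipschitz_on_vec_nth[OF \<phi>]])
qed

text \<open>The field stands on the left of the cross product and the kernel on the right, which
  reverses the signs of the classical curl. In a double curl the reversals cancel.\<close>

lemma nl_curl_components:
  assumes \<phi>: "L-lipschitz_on UNIV \<phi>"
  shows "nl_curl s \<delta> w \<phi> x $ 1 = D 3 (\<lambda>y. \<phi> y $ 2) x - D 2 (\<lambda>y. \<phi> y $ 3) x"
    and "nl_curl s \<delta> w \<phi> x $ 2 = D 1 (\<lambda>y. \<phi> y $ 3) x - D 3 (\<lambda>y. \<phi> y $ 1) x"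
    and "nl_curl s \<delta> w \<phi> x $ 3 = D 2 (\<lambda>y. \<phi> y $ 1) x - D 1 (\<lambda>y. \<phi> y $ 2) x"
proof -
  note [measurable] = lipschitz_on_UNIV_borel_measurable[OF \<phi>]
  let ?g = "\<lambda>z. cross3 (\<phi> x - \<phi> (x - z)) (K z)"
  have int: "integrable lborel ?g"
  proof (rule integrable_kernel_bound)
    fix z
    \<comment> \<open>The squares are compared by Lagrange's identity.\<close>
    have "norm (?g z) \<le> norm (\<phi> x - \<phi> (x - z)) * norm (K z)"
      by (rule power2_le_imp_le) (simp_all add: norm_cross power_mult_distrib)
    also have "\<dots> \<le> (L * norm z) * norm (K z)"
      using lipschitz_onD[OF \<phi>, of x "x - z"] by (intro mult_right_mono) (auto simp: dist_norm)
    finally show "norm (?g z) \<le> L * (norm z * norm (K z))" by (simp add: mult_ac)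
  qed measurable
  let ?h = "\<lambda>y. indicator (ball x \<delta>) y *\<^sub>R
     (w (x - y) *\<^sub>R cross3 (\<phi> x - \<phi> y) ((x - y) /\<^sub>R (norm (x - y) powr (4 + s))))"
  have "nl_curl s \<delta> w \<phi> x = frac_const 3 s *\<^sub>R (\<integral>y. ?h y \<partial>lborel)"
    by (simp add: nl_curl_def set_lebesgue_integral_def)
  also have "(\<integral>y. ?h y \<partial>lborel) = (\<integral>z. ?h (x - z) \<partial>lborel)"
    by (rule lborel_integral_reflect[symmetric]) measurable
  also have "(\<lambda>z. ?h (x - z)) = ?g"
    by (auto simp: nl_kernel_def indicator_def dist_norm add_ac cross_mult_right)
  finally have eq: "nl_curl s \<delta> w \<phi> x $ i = frac_const 3 s * (\<integral>z. ?g z $ i \<partial>lborel)" for i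
    using int by (simp add: integral_bounded_linear[OF bounded_linear_vec_nth, symmetric])
  show "nl_curl s \<delta> w \<phi> x $ 1 = D 3 (\<lambda>y. \<phi> y $ 2) x - D 2 (\<lambda>y. \<phi> y $ 3) x"
    and "nl_curl s \<delta> w \<phi> x $ 2 = D 1 (\<lambda>y. \<phi> y $ 3) x - D 3 (\<lambda>y. \<phi> y $ 1) x"
    and "nl_curl s \<delta> w \<phi> x $ 3 = D 2 (\<lambda>y. \<phi> y $ 1) x - D 1 (\<lambda>y. \<phi> y $ 2) x"
    by (simp_all add: eq D_eq cross_components right_diff_distrib[of "frac_const 3 s"]
        integrable_component[OF lipschitz_on_vec_nth[OF \<phi>]] mult.commute[of "vec_nth (K _) _"])
qed

end

section \<open>The three identities, from commuting components\<close>

theorem proposition3p2: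
  fixes s \<delta> :: real and w u :: "real^3 \<Rightarrow> real" and \<phi> :: "real^3 \<Rightarrow> real^3"
  assumes "0 < s" and "s < 1" and "\<delta> > 0"
    and "radial_cutoff \<delta> w"
    and "test_function u" and "test_function \<phi>"
  shows "\<forall>x.
     nl_curl s \<delta> w (nl_grad s \<delta> w u) x = 0 \<and>
     nl_div s \<delta> w (nl_curl s \<delta> w \<phi>) x = 0 \<and>
     nl_curl s \<delta> w (nl_curl s \<delta> w \<phi>) x
       = nl_grad s \<delta> w (nl_div s \<delta> w \<phi>) x - nl_div_grad s \<delta> w \<phi> x"
proof
  fix x
  interpret nl_operators s \<delta> w
    using assms by unfold_locales
  \<comment> \<open>Hiding the constants turns linearity of \<open>D i\<close> into conditional
    rewrite rules with simple premises.\<close>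
  define lip :: "(real^3 \<Rightarrow> real) \<Rightarrow> bool" where "lip f \<longleftrightarrow> (\<exists>L. L-lipschitz_on UNIV f)" for f
  have lip_diff: "lip (\<lambda>y. f y - g y)" and lip_add: "lip (\<lambda>y. f y + g y)" if "lip f" "lip g" for f g
    using that lipschitz_on_diff lipschitz_on_add unfolding lip_def by blast+
  have D_diff: "D i (\<lambda>y. f y - g y) y = D i f y - D i g y"
    and D_add: "D i (\<lambda>y. f y + g y) y = D i f y + D i g y" if "lip f" "lip g" for i f g y
    using that pd_diff pd_add unfolding lip_def by blast+
  have lip_vec: "\<exists>L. L-lipschitz_on UNIV F" if "\<And>i. lip (\<lambda>y. F y $ i)" for F :: "real^3 \<Rightarrow> real^3"
    using that lipschitz_on_vec_lambda[of UNIV F] unfolding lip_def by metis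

  obtain Lu where Lu: "Lu-lipschitz_on UNIV u"
    using assms(5) test_function_lipschitz by blast
  obtain Mu where Mu: "\<And>z. (Mu * norm z)-lipschitz_on UNIV (\<lambda>y. u y - u (y - z))"
    using assms(5) test_function_lipschitz_difference by blast
  obtain L where L: "L-lipschitz_on UNIV \<phi>"
    using assms(6) test_function_lipschitz by blast
  obtain M where "\<And>z. (M * norm z)-lipschitz_on UNIV (\<lambda>y. \<phi> y - \<phi> (y - z))"
    using assms(6) test_function_lipschitz_difference by blast
  from lipschitz_on_vec_nth[OF this]
  have M: "(M * norm z)-lipschitz_on UNIV (\<lambda>y. \<phi> y $ j - \<phi> (y - z) $ j)" for z j
    by simp
  note Lj = lipschitz_on_vec_nth[OF L]
  define d where "d i j = D i (\<lambda>y. \<phi> y $ j)" for i j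
  \<comment> \<open>The inner operator must return Lipschitz functions, since the component formulas
    for the outer one require them.\<close>
  have lip_Du: "lip (D i u)" for i
    using pd_lipschitz[OF Lu Mu] unfolding lip_def by metis
  have lip_d [simp]: "lip (d i j)" for i j
    using pd_lipschitz[OF Lj M] unfolding lip_def d_def by metis
  have comm: "D i (d j k) y = D j (d i k) y" for i j k y
    unfolding d_def by (rule pd_commute[OF Lj M])

  have grad_u: "(\<lambda>y. nl_grad s \<delta> w u y $ i) = D i u" for i
    using nl_grad_component[OF Lu] by blast
  obtain L1 where L1: "L1-lipschitz_on UNIV (nl_grad s \<delta> w u)"
    using lip_vec lip_Du grad_u by metis
  have "nl_curl s \<delta> w (nl_grad s \<delta> w u) x = 0"
    using pd_commute[OF Lu Mu]
    by (simp add: vec_eq_iff forall_3 nl_curl_components[OF L1] grad_u)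

  moreover
  \<comment> \<open>Equalities of functions can rewrite the argument of an outer
    \<open>D i\<close>.\<close>
  have curl: "(\<lambda>y. nl_curl s \<delta> w \<phi> y $ 1) = (\<lambda>y. d 3 2 y - d 2 3 y)"
    "(\<lambda>y. nl_curl s \<delta> w \<phi> y $ 2) = (\<lambda>y. d 1 3 y - d 3 1 y)"
    "(\<lambda>y. nl_curl s \<delta> w \<phi> y $ 3) = (\<lambda>y. d 2 1 y - d 1 2 y)"
    by (simp_all add: nl_curl_components[OF L] d_def)
  have "lip (\<lambda>y. nl_curl s \<delta> w \<phi> y $ i)" for i
    using exhaust_3[of i] by (auto simp: curl lip_diff)
  then obtain L2 where L2: "L2-lipschitz_on UNIV (nl_curl s \<delta> w \<phi>)"
    using lip_vec by metis
  \<comment> \<open>Six terms cancel in pairs; the chosen instances of \<open>comm\<close> move the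
    smaller index outside.\<close>
  have "nl_div s \<delta> w (nl_curl s \<delta> w \<phi>) x = 0"
    by (simp add: nl_div_eq[OF L2] curl D_diff comm[of 2 1] comm[of 3 1] comm[of 3 2])

  moreover
  have div: "nl_div s \<delta> w \<phi> = (\<lambda>y. d 1 1 y + d 2 2 y + d 3 3 y)"
    by (rule ext) (simp add: nl_div_eq[OF L] d_def)
  have "lip (nl_div s \<delta> w \<phi>)"
    unfolding div by (intro lip_add lip_d)
  then obtain L3 where L3: "L3-lipschitz_on UNIV (nl_div s \<delta> w \<phi>)"
    unfolding lip_def by blast
  have grad: "(\<lambda>y. nl_grad s \<delta> w (\<lambda>y. \<phi> y $ j) y $ i) = d i j" for i j
    using nl_grad_component[OF Lj] by (simp add: d_def)
  have div_grad: "nl_div_grad s \<delta> w \<phi> x $ j = D 1 (d 1 j) x + D 2 (d 2 j) x + D 3 (d 3 j) x" for j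
  proof -
    obtain L4 where "L4-lipschitz_on UNIV (nl_grad s \<delta> w (\<lambda>y. \<phi> y $ j))"
      using lip_vec grad lip_d by metis
    then show ?thesis
      by (simp add: nl_div_grad_def nl_div_eq grad)
  qed
  \<comment> \<open>In component \<open>i\<close> the term \<open>D i (d i i)\<close> cancels on the
    right, and \<open>comm\<close> matches the others. \<open>div\<close> is unfolded only in the
    second pass because \<open>L3\<close> speaks of the folded divergence.\<close>
  have "nl_curl s \<delta> w (nl_curl s \<delta> w \<phi>) x
      = nl_grad s \<delta> w (nl_div s \<delta> w \<phi>) x - nl_div_grad s \<delta> w \<phi> x"
    unfolding vec_eq_iff forall_3
    by (simp add: nl_curl_components[OF L2] curl div_grad nl_grad_component[OF L3])
      (simp add: div D_diff D_add lip_add comm[of 2 1] comm[of 3 1] comm[of 3 2])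
  ultimately show "nl_curl s \<delta> w (nl_grad s \<delta> w u) x = 0 \<and>
     nl_div s \<delta> w (nl_curl s \<delta> w \<phi>) x = 0 \<and>
     nl_curl s \<delta> w (nl_curl s \<delta> w \<phi>) x
       = nl_grad s \<delta> w (nl_div s \<delta> w \<phi>) x - nl_div_grad s \<delta> w \<phi> x"
    by blast
qed

end
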